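(* Let $n, N \ge 1$ be integers, let $t_0 < t_1 < \dots < t_N$ be real numbers, and let $A_0, A_1, \dots, A_N \in \mathbb{R}^{n\times n}$. Let $\mathcal{A}:\mathbb{R}\to\mathbb{R}^{n\times n}$ be the piecewise linear function of time given by $$\mathcal{A}(t) = \alpha_k(t) A_k + (1-\alpha_k(t)) A_{k-1}\quad\text{for } t\in[t_{k-1},t_k],\qquad \alpha_k(t) = \frac{t-t_{k-1}}{t_k-t_{k-1}},\quad k=1,\dots,N,$$ with $\mathcal{A}(t)=A_0$ for $t\le t_0$ and $\mathcal{A}(t)=A_N$ for $t\ge t_N$. Let $\varepsilon_0,\varepsilon_1,\dots,\varepsilon_N>0$ be prescribed real numbers and put $\gamma_k = (t_k-t_{k-1})^{-1}$ for $k=1,\dots,N$. Suppose there exist symmetric matrices $P_0,\dots,P_N\in\mathbb{R}^{n\times n}$, symmetric matrices $\Gamma_1,\dots,\Gamma_N\in\mathbb{R}^{n\times n}$, and matrices $S_1,\dots,S_N\in\mathbb{R}^{n\times n}$ such that $$P_0\succ 0,\qquad P_0A_0 + A_0^\top P_0 + \varepsilon_0 P_0 \prec 0,\qquad P_NA_N + A_N^\top P_N + \varepsilon_N P_N \prec 0,$$ and, for every $k\in\{1,\dots,N\}$, $$\begin{bmatrix} M_k-\Gamma_k & L_k+\tfrac12\Gamma_k+S_k\\ \left(L_k+\tfrac12\Gamma_k+S_k\right)^\top & N_k\end{bmatrix}\prec 0,\qquad \Gamma_k\succ 0,\qquad P_k\succ 0,\qquad S_k^\top=-S_k,$$ where,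 with $\langle X\rangle_S := X+X^\top$, $$M_k = \big\langle P_kA_k-(P_kA_{k-1}+P_{k-1}A_k)+P_{k-1}A_{k-1}\big\rangle_S,$$ $$L_k = \Big\langle \tfrac12(P_kA_{k-1}+P_{k-1}A_k)-P_{k-1}A_{k-1}\Big\rangle_S+\tfrac{\varepsilon_k}{2}(P_k-P_{k-1}),$$ $$N_k = \big\langle P_{k-1}A_{k-1}\big\rangle_S+\gamma_k(P_k-P_{k-1})+\varepsilon_kP_{k-1}.$$ Then the linear time-varying system $\dot x(t)=\mathcal{A}(t)x(t)$ is globally uniformly exponentially stable.
   Context: For a real symmetric matrix $X$, $X\succ0$ (resp. $X\prec0$) means that $X$ is positive definite (resp. negative definite). The subscripted symbols $N_k$ denote matrices and are unrelated to the integer $N$ (the number of time intervals). The system $\dot x(t)=\mathcal{A}(t)x(t)$, $x(t)\in\mathbb{R}^n$, is globally uniformly exponentially stable if there exist constants $c\ge 1$ and $\lambda>0$ such that for every initial time $s\in\mathbb{R}$ and every initial state $x(s)\in\mathbb{R}^n$ the corresponding solution satisfies $\|x(t)\|\le c\,e^{-\lambda(t-s)}\|x(s)\|$ for all $t\ge s$. *)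

theory Defs
  imports "HOL-Analysis.Analysis"
begin

definition symmetric_matrix :: "real^'n^'n \<Rightarrow> bool" where
  "symmetric_matrix X \<longleftrightarrow> transpose X = X"

definition positive_definite :: "real^'n^'n \<Rightarrow> bool" where
  "positive_definite X \<longleftrightarrow> symmetric_matrix X \<and> (\<forall>x. x \<noteq> 0 \<longrightarrow> x \<bullet> (X *v x) > 0)"

definition negative_definite :: "real^'n^'n \<Rightarrow> bool" where
  "negative_definite X \<longleftrightarrow> symmetric_matrix X \<and> (\<forall>x. x \<noteq> 0 \<longrightarrow> x \<bullet> (X *v x) < 0)"

(* The 2n x 2n matrix [A, B; C, D]: Inl indexes the first n rows/columns, Inr the last n. *)
definition block_matrix ::
  "real^'n^'n \<Rightarrow> real^'n^'n \<Rightarrow> real^'n^'n \<Rightarrow> real^'n^'n \<Rightarrow> real^('n + 'n)^('n + 'n)" where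
  "block_matrix A B C D = (\<chi> i j.
     case i of
       Inl p \<Rightarrow> (case j of Inl q \<Rightarrow> A $ p $ q | Inr q \<Rightarrow> B $ p $ q)
     | Inr p \<Rightarrow> (case j of Inl q \<Rightarrow> C $ p $ q | Inr q \<Rightarrow> D $ p $ q))"

(* The bracket <X>_S; note that there is no factor 1/2. *)
definition sym_sum :: "real^'n^'n \<Rightarrow> real^'n^'n" where
  "sym_sum X = X + transpose X"

definition interp_weight :: "(nat \<Rightarrow> real) \<Rightarrow> nat \<Rightarrow> real \<Rightarrow> real" where
  "interp_weight t k \<tau> = (\<tau> - t (k - 1)) / (t k - t (k - 1))"

definition M_mat :: "(nat \<Rightarrow> real^'n^'n) \<Rightarrow> (nat \<Rightarrow> real^'n^'n) \<Rightarrow> nat \<Rightarrow> real^'n^'n" where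
  "M_mat A P k = sym_sum
     (P k ** A k - (P k ** A (k - 1) + P (k - 1) ** A k) + P (k - 1) ** A (k - 1))"

definition L_mat ::
  "(nat \<Rightarrow> real) \<Rightarrow> (nat \<Rightarrow> real^'n^'n) \<Rightarrow> (nat \<Rightarrow> real^'n^'n) \<Rightarrow> nat \<Rightarrow> real^'n^'n" where
  "L_mat \<epsilon> A P k = sym_sum
     ((1 / 2) *\<^sub>R (P k ** A (k - 1) + P (k - 1) ** A k) - P (k - 1) ** A (k - 1))
     + (\<epsilon> k / 2) *\<^sub>R (P k - P (k - 1))"

definition N_mat ::
  "(nat \<Rightarrow> real) \<Rightarrow> (nat \<Rightarrow> real) \<Rightarrow> (nat \<Rightarrow> real^'n^'n) \<Rightarrow> (nat \<Rightarrow> real^'n^'n) \<Rightarrow> nat \<Rightarrow> real^'n^'n" where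
  "N_mat \<gamma> \<epsilon> A P k = sym_sum (P (k - 1) ** A (k - 1))
     + \<gamma> k *\<^sub>R (P k - P (k - 1)) + \<epsilon> k *\<^sub>R P (k - 1)"

(* At the initial time s the derivative is the right-hand one. *)
definition solves_ltv_from ::
  "(real \<Rightarrow> real^'n^'n) \<Rightarrow> real \<Rightarrow> (real \<Rightarrow> real^'n) \<Rightarrow> bool" where
  "solves_ltv_from \<A> s x \<longleftrightarrow>
     (\<forall>\<tau>\<ge>s. (x has_vector_derivative (\<A> \<tau> *v x \<tau>)) (at \<tau> within {s..}))"

definition globally_uniformly_exponentially_stable :: "(real \<Rightarrow> real^'n^'n) \<Rightarrow> bool" where
  "globally_uniformly_exponentially_stable \<A> \<longleftrightarrow>
     (\<exists>c r. c \<ge> 1 \<and> r > 0 \<and>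
       (\<forall>s x. solves_ltv_from \<A> s x \<longrightarrow>
         (\<forall>\<tau>\<ge>s. norm (x \<tau>) \<le> c * exp (- r * (\<tau> - s)) * norm (x s))))"

end

theory Submission
  imports Defs
begin

text \<open>
  Interpolate the matrices \<open>P k\<close> linearly in time, exactly as \<open>A k\<close>, to a continuous function \<open>Q\<close>; the
  Lyapunov function is \<open>V \<tau> = x \<tau> \<bullet> (Q \<tau> *v x \<tau>)\<close>. On the \<open>k\<close>-th interval, with weight \<open>\<alpha> \<in> [0, 1]\<close>,
  the quantity \<open>V' + \<epsilon> k * V\<close> is the quadratic polynomial \<open>\<alpha>\<^sup>2 M + 2 \<alpha> L + N\<close> evaluated at \<open>x\<close>.
  Testing the block matrix at the vector \<open>(\<alpha> x, x)\<close> gives this polynomial plus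
  \<open>\<alpha> (1 - \<alpha>) \<Gamma>\<close> (the skew matrix \<open>S\<close> drops out), hence it is negative.
  So \<open>exp (r * \<tau>) * V \<tau>\<close> is nonincreasing for \<open>r = Min (\<epsilon> k)\<close>, and the uniform definiteness of \<open>Q\<close>
  turns this into exponential decay of the norm with rate \<open>r / 2\<close>.
\<close>

section \<open>Quadratic forms\<close>

definition quad_form :: "real^'n^'n \<Rightarrow> real^'n \<Rightarrow> real" where
  "quad_form X x = x \<bullet> (X *v x)"

lemma quad_form_add: "quad_form (X + Y) x = quad_form X x + quad_form Y x"
  by (simp add: quad_form_def matrix_vector_mult_add_rdistrib inner_add_right)

lemma quad_form_diff: "quad_form (X - Y) x = quad_form X x - quad_form Y x"
  by (simp add: quad_form_def matrix_vector_mult_diff_rdistrib inner_diff_right)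

lemma quad_form_scaleR: "quad_form (c *\<^sub>R X) x = c * quad_form X x"
  by (simp add: quad_form_def scaleR_matrix_vector_assoc[symmetric])

lemma quad_form_scaleR_right: "quad_form X (c *\<^sub>R x) = c\<^sup>2 * quad_form X x"
  by (simp add: quad_form_def matrix_vector_mult_scaleR power2_eq_square)

lemma inner_transpose: "x \<bullet> (transpose X *v y) = y \<bullet> (X *v x)"
  for X :: "real^'n^'n"
  by (metis dot_lmul_matrix inner_commute transpose_matrix_vector)

lemma quad_form_transpose: "quad_form (transpose X) x = quad_form X x"
  unfolding quad_form_def by (rule inner_transpose)

lemma quad_form_sym_sum: "quad_form (sym_sum X) x = 2 * quad_form X x"
  by (simp add: sym_sum_def quad_form_add quad_form_transpose)

lemma quad_form_skew:
  assumes "transpose X = - X"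
  shows "quad_form X x = 0"
proof -
  have "quad_form X x = quad_form (0 - X) x"
    using quad_form_transpose[of X x] assms by simp
  also have "\<dots> = - quad_form X x"
    unfolding quad_form_diff by (simp add: quad_form_def)
  finally show ?thesis by simp
qed

lemma inner_symmetric_matrix:
  assumes "symmetric_matrix X"
  shows "y \<bullet> (X *v x) = x \<bullet> (X *v y)"
  using assms by (metis inner_transpose symmetric_matrix_def)

text \<open>By symmetry of \<open>P\<close> the second summand is the transpose of the first, so
  both contribute the same form. This puts the conditions at the two ends in the shape of a
  derivative along solutions.\<close>

lemma quad_form_lyapunov:
  assumes "symmetric_matrix P"
  shows "quad_form (P ** A + transpose A ** P) x = 2 * (x \<bullet> (P *v (A *v x)))"
proof -
  have "transpose A ** P = transpose (P ** A)"
    using assms by (simp add: symmetric_matrix_def matrix_transpose_mul)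
  then show ?thesis
    by (simp add: quad_form_add quad_form_transpose)
      (simp add: quad_form_def matrix_vector_mul_assoc)
qed

section \<open>Forms of 2 x 2 block matrices at stacked vectors\<close>

lemma sum_UNIV_Plus:
  fixes f :: "'a::finite + 'b::finite \<Rightarrow> 'c::comm_monoid_add"
  shows "sum f UNIV = (\<Sum>i\<in>UNIV. f (Inl i)) + (\<Sum>j\<in>UNIV. f (Inr j))"
  using sum.Plus[of UNIV UNIV f] by simp

lemma quad_form_block_matrix:
  fixes A B C D :: "real^'n^'n"
  shows "quad_form (block_matrix A B C D) (\<chi> i. case i of Inl p \<Rightarrow> u $ p | Inr p \<Rightarrow> v $ p)
    = u \<bullet> (A *v u) + u \<bullet> (B *v v) + v \<bullet> (C *v u) + v \<bullet> (D *v v)"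
  by (simp add: quad_form_def inner_vec_def matrix_vector_mult_def block_matrix_def
      sum_UNIV_Plus distrib_left sum.distrib)

section \<open>Sign and size of definite forms\<close>

lemma quad_form_pos:
  assumes "positive_definite X" "x \<noteq> 0"
  shows "quad_form X x > 0"
  using assms by (simp add: positive_definite_def quad_form_def)

lemma quad_form_nonneg:
  assumes "positive_definite X"
  shows "quad_form X x \<ge> 0"
  using quad_form_pos[OF assms, of x] by (cases "x = 0") (simp_all add: quad_form_def)

lemma quad_form_nonpos:
  assumes "negative_definite X"
  shows "quad_form X x \<le> 0"
  using assms by (cases "x = 0") (auto simp: negative_definite_def quad_form_def less_imp_le)

text \<open>On the compact unit sphere the continuous form attains its minimum and maximum; the
  minimum is positive by definiteness. Homogeneity of degree 2 carries both bounds to all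
  vectors.\<close>

lemma positive_definite_bounds:
  fixes X :: "real^'n^'n"
  assumes "positive_definite X"
  shows "\<exists>a>0. \<exists>b. \<forall>x. a * (norm x)\<^sup>2 \<le> quad_form X x \<and> quad_form X x \<le> b * (norm x)\<^sup>2"
proof -
  let ?S = "sphere (0::real^'n) 1"
  have cont: "continuous_on ?S (quad_form X)"
    unfolding quad_form_def by (intro continuous_intros)
  have ne: "?S \<noteq> {}" by simp
  obtain y where y: "y \<in> ?S" "\<forall>x\<in>?S. quad_form X y \<le> quad_form X x"
    using continuous_attains_inf[OF compact_sphere ne cont] by blast
  obtain z where z: "z \<in> ?S" "\<forall>x\<in>?S. quad_form X x \<le> quad_form X z"
    using continuous_attains_sup[OF compact_sphere ne cont] by blast
  have "y \<noteq> 0" using y(1) by auto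
  then have pos: "quad_form X y > 0"
    using assms quad_form_pos by blast
  have "quad_form X y * (norm x)\<^sup>2 \<le> quad_form X x \<and> quad_form X x \<le> quad_form X z * (norm x)\<^sup>2"
    for x
  proof (cases "x = 0")
    case True
    then show ?thesis by (simp add: quad_form_def)
  next
    case False
    define e where "e = (1 / norm x) *\<^sub>R x"
    have e: "e \<in> ?S" and x: "x = norm x *\<^sub>R e"
      using False by (simp_all add: e_def)
    have "quad_form X x = (norm x)\<^sup>2 * quad_form X e"
      using x quad_form_scaleR_right by metis
    then show ?thesis
      using y(2) z(2) e by (simp add: mult.commute mult_right_mono)
  qed
  with pos show ?thesis by blast
qed

text \<open>One pair of constants for all nodes is what later makes the stability estimate uniform
  in the initial time.\<close>

lemma positive_definite_bounds_finite:
  fixes P :: "'i \<Rightarrow> real^'n^'n"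
  assumes "finite I" "\<And>i. i \<in> I \<Longrightarrow> positive_definite (P i)"
  shows "\<exists>a>0. \<exists>b. \<forall>i\<in>I. \<forall>x. a * (norm x)\<^sup>2 \<le> quad_form (P i) x \<and> quad_form (P i) x \<le> b * (norm x)\<^sup>2"
  using assms
proof (induction I rule: finite_induct)
  case empty
  show ?case by (auto intro: exI[of _ 1])
next
  case (insert i I)
  obtain a b where ab: "a > 0"
    "\<forall>j\<in>I. \<forall>x. a * (norm x)\<^sup>2 \<le> quad_form (P j) x \<and> quad_form (P j) x \<le> b * (norm x)\<^sup>2"
    using insert by auto
  obtain a' b' where ab': "a' > 0"
    "\<forall>x. a' * (norm x)\<^sup>2 \<le> quad_form (P i) x \<and> quad_form (P i) x \<le> b' * (norm x)\<^sup>2"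
    using positive_definite_bounds[of "P i"] insert by auto
  have *: "min a a' * (norm x)\<^sup>2 \<le> a * (norm x)\<^sup>2" "min a a' * (norm x)\<^sup>2 \<le> a' * (norm x)\<^sup>2"
    "b * (norm x)\<^sup>2 \<le> max b b' * (norm x)\<^sup>2" "b' * (norm x)\<^sup>2 \<le> max b b' * (norm x)\<^sup>2"
    for x :: "real^'n"
    by (simp_all add: mult_right_mono)
  show ?case
    using ab ab' by (intro exI[of _ "min a a'"] conjI exI[of _ "max b b'"])
      (auto intro: order_trans[OF *(1)] order_trans[OF *(2)] order_trans[OF _ *(3)] order_trans[OF _ *(4)])
qed

section \<open>The matrix inequality on one interval\<close>

text \<open>If the weight \<open>w\<close> moves with slope \<open>\<gamma> k\<close>, the left side
  is V' + \<open>\<epsilon> k\<close> V for the interpolated Lyapunov function. Both interpolants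
  are affine in \<open>w\<close>, so it is a quadratic polynomial in \<open>w\<close>, and M, L, N
  are defined so as to collect its coefficients.\<close>

lemma interval_form_eq:
  fixes A P :: "nat \<Rightarrow> real^'n^'n" and k :: nat
  defines "W \<equiv> \<lambda>w. P (k - 1) + w *\<^sub>R (P k - P (k - 1))"
  shows "2 * (x \<bullet> (W w *v ((w *\<^sub>R A k + (1 - w) *\<^sub>R A (k - 1)) *v x)))
      + \<gamma> k * quad_form (P k - P (k - 1)) x + \<epsilon> k * quad_form (W w) x
    = w\<^sup>2 * quad_form (M_mat A P k) x + 2 * w * quad_form (L_mat \<epsilon> A P k) x
      + quad_form (N_mat \<gamma> \<epsilon> A P k) x"
proof -
  \<comment> \<open>Naming these scalars turns the matrix identity into a polynomial identity over
    the reals.\<close>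
  define a where "a i j = x \<bullet> (P i *v (A j *v x))" for i j
  have a: "quad_form (P i ** A j) x = a i j" for i j
    by (simp add: quad_form_def a_def matrix_vector_mul_assoc)
  have "x \<bullet> (W w *v ((w *\<^sub>R A k + (1 - w) *\<^sub>R A (k - 1)) *v x))
    = w * a (k - 1) k + (1 - w) * a (k - 1) (k - 1)
      + w * (w * (a k k - a (k - 1) k) + (1 - w) * (a k (k - 1) - a (k - 1) (k - 1)))"
    by (simp add: W_def a_def matrix_vector_mult_add_rdistrib matrix_vector_mult_diff_rdistrib
        matrix_vector_right_distrib matrix_vector_mult_scaleR
        scaleR_matrix_vector_assoc[symmetric] inner_add_right inner_diff_right)
      (simp add: algebra_simps)
  then show ?thesis
    by (simp add: W_def M_mat_def L_mat_def N_mat_def quad_form_add quad_form_diff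
        quad_form_scaleR quad_form_sym_sum a)
      (simp add: field_simps power2_eq_square)
qed

lemma block_negative_imp_form_nonpos:
  fixes M L N \<Gamma> S :: "real^'n^'n"
  assumes neg: "negative_definite (block_matrix (M - \<Gamma>) (L + (1 / 2) *\<^sub>R \<Gamma> + S)
      (transpose (L + (1 / 2) *\<^sub>R \<Gamma> + S)) N)"
    and "positive_definite \<Gamma>" and skew: "transpose S = - S" and w: "0 \<le> w" "w \<le> 1"
  shows "w\<^sup>2 * quad_form M x + 2 * w * quad_form L x + quad_form N x \<le> 0"
proof -
  let ?B = "L + (1 / 2) *\<^sub>R \<Gamma> + S"
  have "quad_form (block_matrix (M - \<Gamma>) ?B (transpose ?B) N)
      (\<chi> i. case i of Inl p \<Rightarrow> (w *\<^sub>R x) $ p | Inr p \<Rightarrow> x $ p)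
    = w\<^sup>2 * quad_form (M - \<Gamma>) x + 2 * w * quad_form ?B x + quad_form N x"
    unfolding quad_form_block_matrix inner_transpose
    by (simp add: quad_form_def matrix_vector_mult_scaleR power2_eq_square)
  \<comment> \<open>\<open>\<Gamma>\<close> enters with -\<open>w\<^sup>2\<close> from the upper
    left block and with 2\<open>w\<close> times 1/2 from the two off-diagonal blocks, which leaves
    the factor \<open>w * (1 - w)\<close>. It is nonnegative precisely on [0, 1].\<close>
  also have "\<dots> = w\<^sup>2 * quad_form M x + 2 * w * quad_form L x + quad_form N x
      + w * (1 - w) * quad_form \<Gamma> x"
    by (simp add: quad_form_add quad_form_diff quad_form_scaleR quad_form_skew[OF skew])
      (simp add: algebra_simps power2_eq_square)
  \<comment> \<open>The non-strict inequality also covers \<open>x = 0\<close>; it suffices because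
    the decay rate is already contained in the \<open>\<epsilon>\<close> terms.\<close>
  finally have "w\<^sup>2 * quad_form M x + 2 * w * quad_form L x + quad_form N x
      + w * (1 - w) * quad_form \<Gamma> x \<le> 0"
    using quad_form_nonpos[OF neg] by metis
  moreover have "w * (1 - w) * quad_form \<Gamma> x \<ge> 0"
    using w quad_form_nonneg[OF assms(2)] by simp
  ultimately show ?thesis by linarith
qed

section \<open>Decay along solutions\<close>

text \<open>The derivative of \<open>exp (r * \<tau>)\<close> times the form is
  \<open>exp (r * \<tau>)\<close> times the left side of \<open>le\<close>, hence nonpositive. The
  choice \<open>D = 0\<close> gives the case of a constant Lyapunov matrix, so the lemma serves the
  grid intervals and both outer half-lines.\<close>

lemma lyapunov_decay:
  fixes x :: "real \<Rightarrow> real^'n" and B :: "real \<Rightarrow> real^'n^'n"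
  assumes "a \<le> b" and sym: "symmetric_matrix X" "symmetric_matrix D"
    and x: "\<And>\<tau>. \<tau> \<in> {a..b} \<Longrightarrow> (x has_vector_derivative (B \<tau> *v x \<tau>)) (at \<tau> within {a..b})"
    and w: "\<And>\<tau>. \<tau> \<in> {a..b} \<Longrightarrow> (w has_real_derivative g) (at \<tau> within {a..b})"
    and le: "\<And>\<tau>. \<tau> \<in> {a..b} \<Longrightarrow>
      2 * (x \<tau> \<bullet> ((X + w \<tau> *\<^sub>R D) *v (B \<tau> *v x \<tau>))) + g * quad_form D (x \<tau>)
        + r * quad_form (X + w \<tau> *\<^sub>R D) (x \<tau>) \<le> 0"
  shows "exp (r * b) * quad_form (X + w b *\<^sub>R D) (x b)
    \<le> exp (r * a) * quad_form (X + w a *\<^sub>R D) (x a)"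
proof -
  let ?f = "\<lambda>\<tau>. exp (r * \<tau>) * quad_form (X + w \<tau> *\<^sub>R D) (x \<tau>)"
  let ?f' = "\<lambda>\<tau>. exp (r * \<tau>) * (2 * (x \<tau> \<bullet> ((X + w \<tau> *\<^sub>R D) *v (B \<tau> *v x \<tau>)))
    + g * quad_form D (x \<tau>) + r * quad_form (X + w \<tau> *\<^sub>R D) (x \<tau>))"
  have deriv: "(?f has_real_derivative ?f' \<tau>) (at \<tau> within {a..b})" if \<tau>: "\<tau> \<in> {a..b}" for \<tau>
  proof -
    \<comment> \<open>Symmetry of \<open>Y\<close> merges the two terms of the product rule into
      one.\<close>
    have q: "((\<lambda>\<tau>. quad_form Y (x \<tau>)) has_real_derivative 2 * (x \<tau> \<bullet> (Y *v (B \<tau> *v x \<tau>))))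
        (at \<tau> within {a..b})" if "symmetric_matrix Y" for Y
    proof -
      have "((\<lambda>\<tau>. Y *v x \<tau>) has_vector_derivative Y *v (B \<tau> *v x \<tau>)) (at \<tau> within {a..b})"
        by (rule bounded_linear.has_vector_derivative[OF matrix_vector_mul_bounded_linear x[OF \<tau>]])
      from bounded_bilinear.has_vector_derivative[OF bounded_bilinear_inner x[OF \<tau>] this]
      show ?thesis
        using inner_symmetric_matrix[OF that, of "B \<tau> *v x \<tau>" "x \<tau>"]
        by (simp add: quad_form_def has_real_derivative_iff_has_vector_derivative)
    qed
    show ?thesis
      unfolding quad_form_add quad_form_scaleR
      by (rule derivative_eq_intros q[OF sym(1)] q[OF sym(2)] w[OF \<tau>] refl)+
        (simp add: matrix_vector_mult_add_rdistrib scaleR_matrix_vector_assoc[symmetric]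
          inner_add_right algebra_simps)
  qed
  show ?thesis
  \<comment> \<open>Derivatives within \<open>{a..b}\<close> are two-sided in the interior, and at
    the endpoints only continuity is required. So one-sided derivatives at the nodes and at the
    initial time suffice.\<close>
  proof (rule DERIV_nonpos_imp_decreasing_open[OF \<open>a \<le> b\<close>])
    fix \<tau> assume "a < \<tau>" "\<tau> < b"
    then have "(?f has_real_derivative ?f' \<tau>) (at \<tau>)"
      using deriv[of \<tau>] at_within_Icc_at[of a \<tau> b] by simp
    moreover have "?f' \<tau> \<le> 0"
      using le[of \<tau>] \<open>a < \<tau>\<close> \<open>\<tau> < b\<close> by (simp add: mult_nonneg_nonpos)
    ultimately show "\<exists>y. (?f has_real_derivative y) (at \<tau>) \<and> y \<le> 0"
      by blast
  next
    show "continuous_on {a..b} ?f"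
      using deriv by (rule DERIV_continuous_on)
  qed
qed

section \<open>The time grid: interpolation between nodes and gluing of monotonicity\<close>

lemma node_mono:
  fixes t :: "nat \<Rightarrow> real"
  assumes "\<And>k. k \<in> {1..N} \<Longrightarrow> t (k - 1) < t k" "i \<le> j" "j \<le> N"
  shows "t i \<le> t j"
  using assms(2,3)
proof (induction rule: dec_induct)
  case (step m)
  then show ?case using assms(1)[of "Suc m"] by simp
qed simp

text \<open>Adjacent affine pieces agree at their common node, so a single function can satisfy all
  the formulas on closed intervals. It is built by appending one interval at a time.\<close>

lemma piecewise_linear_interpolation:
  fixes P :: "nat \<Rightarrow> 'v::real_vector" and t :: "nat \<Rightarrow> real"
  assumes "\<And>k. k \<in> {1..N} \<Longrightarrow> t (k - 1) < t k"
  shows "\<exists>Q. (\<forall>\<tau>\<le>t 0. Q \<tau> = P 0) \<and> (\<forall>\<tau>\<ge>t N. Q \<tau> = P N) \<and>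
    (\<forall>k\<in>{1..N}. \<forall>\<tau>\<in>{t (k - 1)..t k}. Q \<tau> = P (k - 1) + interp_weight t k \<tau> *\<^sub>R (P k - P (k - 1)))"
  using assms
proof (induction N)
  case 0
  show ?case by (auto intro: exI[of _ "\<lambda>_. P 0"])
next
  case (Suc N)
  then obtain Q where Q: "\<forall>\<tau>\<le>t 0. Q \<tau> = P 0" "\<forall>\<tau>\<ge>t N. Q \<tau> = P N"
    "\<forall>k\<in>{1..N}. \<forall>\<tau>\<in>{t (k - 1)..t k}. Q \<tau> = P (k - 1) + interp_weight t k \<tau> *\<^sub>R (P k - P (k - 1))"
    by auto
  \<comment> \<open>Truncating the weight at 1 freezes the new piece at \<open>P (Suc N)\<close>
    beyond the last node. At \<open>t N\<close> itself the old value \<open>P N\<close> matches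
    weight 0.\<close>
  define R where "R \<tau> = (if \<tau> \<le> t N then Q \<tau>
    else P N + min 1 (interp_weight t (Suc N) \<tau>) *\<^sub>R (P (Suc N) - P N))" for \<tau>
  have lt: "t N < t (Suc N)" using Suc.prems[of "Suc N"] by simp
  have le: "t i \<le> t N" if "i \<le> N" for i
    using node_mono[of N t i N] that Suc.prems by auto
  have "R \<tau> = P 0" if "\<tau> \<le> t 0" for \<tau>
    using that Q(1) le[of 0] by (simp add: R_def)
  moreover have "R \<tau> = P (Suc N)" if "\<tau> \<ge> t (Suc N)" for \<tau>
    using that lt by (simp add: R_def interp_weight_def field_simps min_def)
  moreover have "R \<tau> = P (k - 1) + interp_weight t k \<tau> *\<^sub>R (P k - P (k - 1))"
    if "k \<in> {1..Suc N}" "\<tau> \<in> {t (k - 1)..t k}" for k \<tau>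
  proof (cases "k = Suc N")
    case True
    then show ?thesis
      using that lt Q(2) by (auto simp: R_def interp_weight_def min_def field_simps)
  next
    case False
    then show ?thesis
      using that Q(3) le[of k] by (simp add: R_def)
  qed
  ultimately show ?case by (intro exI[of _ R]) blast
qed

text \<open>A pair \<open>a\<close>, \<open>b\<close> on different sides of a node is compared
  through that node, which lies after \<open>s\<close> because \<open>a\<close> does. Induction over
  the nodes handles pairs up to \<open>t N\<close>; one more split at \<open>t N\<close> handles the
  rest.\<close>

lemma piecewise_antimono:
  fixes f :: "real \<Rightarrow> real" and t :: "nat \<Rightarrow> real"
  assumes left: "\<And>a b. s \<le> a \<Longrightarrow> a \<le> b \<Longrightarrow> b \<le> t 0 \<Longrightarrow> f b \<le> f a"
    and mid: "\<And>k a b. k \<in> {1..N} \<Longrightarrow> s \<le> a \<Longrightarrow> t (k - 1) \<le> a \<Longrightarrow> a \<le> b \<Longrightarrow> b \<le> t k \<Longrightarrow> f b \<le> f a"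
    and right: "\<And>a b. s \<le> a \<Longrightarrow> t N \<le> a \<Longrightarrow> a \<le> b \<Longrightarrow> f b \<le> f a"
    and "s \<le> a" "a \<le> b"
  shows "f b \<le> f a"
proof -
  have below: "f b \<le> f a" if "k \<le> N" "s \<le> a" "a \<le> b" "b \<le> t k" for k a b
    using that
  proof (induction k arbitrary: a b)
    case 0
    then show ?case using left by simp
  next
    case (Suc k)
    consider "b \<le> t k" | "t k \<le> a" | "a \<le> t k" "t k \<le> b" by linarith
    then show ?case
    proof cases
      case 3
      have "f b \<le> f (t k)"
        using mid[of "Suc k" "t k" b] Suc.prems 3 by simp
      also have "f (t k) \<le> f a"
        using Suc.IH[of a "t k"] Suc.prems 3 by simp
      finally show ?thesis .
    qed (use Suc mid[of "Suc k" a b] in simp_all)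
  qed
  consider "b \<le> t N" | "t N \<le> a" | "a \<le> t N" "t N \<le> b" by linarith
  then show ?thesis
  proof cases
    case 3
    have "f b \<le> f (t N)" using right 3 assms(4) by simp
    also have "f (t N) \<le> f a" using below[of N a "t N"] 3 assms(4) by simp
    finally show ?thesis .
  qed (use below[of N a b] right assms(4,5) in simp_all)
qed

section \<open>Assembly of the Lyapunov function and the exponential estimate\<close>

theorem theorem1:
  fixes N :: nat
    and t \<epsilon> \<gamma> :: "nat \<Rightarrow> real"
    and A :: "nat \<Rightarrow> real^'n^'n"
    and \<A> :: "real \<Rightarrow> real^'n^'n"
  assumes "N \<ge> 1"
    and "\<And>k. k \<in> {1..N} \<Longrightarrow> t (k - 1) < t k"
    and "\<And>k \<tau>. k \<in> {1..N} \<Longrightarrow> \<tau> \<in> {t (k - 1)..t k} \<Longrightarrow>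
           \<A> \<tau> = interp_weight t k \<tau> *\<^sub>R A k + (1 - interp_weight t k \<tau>) *\<^sub>R A (k - 1)"
    and "\<And>\<tau>. \<tau> \<le> t 0 \<Longrightarrow> \<A> \<tau> = A 0"
    and "\<And>\<tau>. \<tau> \<ge> t N \<Longrightarrow> \<A> \<tau> = A N"
    and "\<And>k. k \<in> {0..N} \<Longrightarrow> \<epsilon> k > 0"
    and "\<And>k. k \<in> {1..N} \<Longrightarrow> \<gamma> k = inverse (t k - t (k - 1))"
    and "\<exists>P \<Gamma> S :: nat \<Rightarrow> real^'n^'n.
           (\<forall>k\<in>{0..N}. symmetric_matrix (P k)) \<and>
           (\<forall>k\<in>{1..N}. symmetric_matrix (\<Gamma> k)) \<and>
           positive_definite (P 0) \<and>
           negative_definite (P 0 ** A 0 + transpose (A 0) ** P 0 + \<epsilon> 0 *\<^sub>R P 0) \<and>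
           negative_definite (P N ** A N + transpose (A N) ** P N + \<epsilon> N *\<^sub>R P N) \<and>
           (\<forall>k\<in>{1..N}.
              negative_definite (block_matrix
                (M_mat A P k - \<Gamma> k)
                (L_mat \<epsilon> A P k + (1 / 2) *\<^sub>R \<Gamma> k + S k)
                (transpose (L_mat \<epsilon> A P k + (1 / 2) *\<^sub>R \<Gamma> k + S k))
                (N_mat \<gamma> \<epsilon> A P k)) \<and>
              positive_definite (\<Gamma> k) \<and> positive_definite (P k) \<and> transpose (S k) = - S k)"
  shows "globally_uniformly_exponentially_stable \<A>"
proof -
  obtain P \<Gamma> S :: "nat \<Rightarrow> real^'n^'n" where
    neg0: "negative_definite (P 0 ** A 0 + transpose (A 0) ** P 0 + \<epsilon> 0 *\<^sub>R P 0)"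
    and negN: "negative_definite (P N ** A N + transpose (A N) ** P N + \<epsilon> N *\<^sub>R P N)"
    and P0: "positive_definite (P 0)"
    and mid: "\<And>k. k \<in> {1..N} \<Longrightarrow>
      negative_definite (block_matrix
        (M_mat A P k - \<Gamma> k) (L_mat \<epsilon> A P k + (1 / 2) *\<^sub>R \<Gamma> k + S k)
        (transpose (L_mat \<epsilon> A P k + (1 / 2) *\<^sub>R \<Gamma> k + S k)) (N_mat \<gamma> \<epsilon> A P k)) \<and>
      positive_definite (\<Gamma> k) \<and> positive_definite (P k) \<and> transpose (S k) = - S k"
    using assms(8) by blast
  have pos: "positive_definite (P k)" if "k \<le> N" for k
    using that P0 mid[of k] by (cases k) auto
  then have sym: "symmetric_matrix (P k)" if "k \<le> N" for k
    using that by (simp add: positive_definite_def)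
  note t_less = assms(2)
  obtain Q :: "real \<Rightarrow> real^'n^'n" where
    QL: "\<And>\<tau>. \<tau> \<le> t 0 \<Longrightarrow> Q \<tau> = P 0" and QR: "\<And>\<tau>. \<tau> \<ge> t N \<Longrightarrow> Q \<tau> = P N"
    and QM: "\<And>k \<tau>. k \<in> {1..N} \<Longrightarrow> \<tau> \<in> {t (k - 1)..t k} \<Longrightarrow>
      Q \<tau> = P (k - 1) + interp_weight t k \<tau> *\<^sub>R (P k - P (k - 1))"
    using piecewise_linear_interpolation[of N t P] t_less by blast
  have weight: "0 \<le> interp_weight t k \<tau>" "interp_weight t k \<tau> \<le> 1"
    if "k \<in> {1..N}" "\<tau> \<in> {t (k - 1)..t k}" for k \<tau>
    using that t_less[of k] by (simp_all add: interp_weight_def)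

  obtain a b where "a > 0" and "\<forall>k\<in>{..N}. \<forall>x.
      a * (norm x)\<^sup>2 \<le> quad_form (P k) x \<and> quad_form (P k) x \<le> b * (norm x)\<^sup>2"
    using positive_definite_bounds_finite[of "{..N}" P] pos by auto
  then have ab: "a * (norm x)\<^sup>2 \<le> quad_form (P k) x \<and> quad_form (P k) x \<le> b * (norm x)\<^sup>2"
    if "k \<le> N" for k x
    using that by simp
  \<comment> \<open>Between nodes the form of \<open>Q \<tau>\<close> is a convex combination of the
    forms of the two neighbouring \<open>P\<close>, so the bounds at the nodes persist at every
    time.\<close>
  have Qab: "a * (norm x)\<^sup>2 \<le> quad_form (Q \<tau>) x \<and> quad_form (Q \<tau>) x \<le> b * (norm x)\<^sup>2" for \<tau> x
  proof -
    let ?I = "{a * (norm x)\<^sup>2..b * (norm x)\<^sup>2}"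
    consider "\<tau> \<le> t 0" | "\<tau> \<ge> t N" | k where "k \<in> {1..N}" "\<tau> \<in> {t (k - 1)..t k}"
    proof -
      \<comment> \<open>A time beyond \<open>t n\<close> lies either in the next interval or beyond
        \<open>t (Suc n)\<close>.\<close>
      have "\<tau> \<le> t 0 \<or> (\<exists>k\<in>{1..n}. \<tau> \<in> {t (k - 1)..t k}) \<or> \<tau> \<ge> t n" for n
      proof (induction n)
        case (Suc n)
        then show ?case
          by (cases "\<tau> \<le> t (Suc n)") (auto intro: bexI[of _ "Suc n"])
      qed auto
      then show ?thesis using that by blast
    qed
    then show ?thesis
    proof cases
      case 3
      let ?w = "interp_weight t k \<tau>"
      have "quad_form (Q \<tau>) x = (1 - ?w) *\<^sub>R quad_form (P (k - 1)) x + ?w *\<^sub>R quad_form (P k) x"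
        unfolding QM[OF 3] by (simp add: quad_form_add quad_form_diff quad_form_scaleR algebra_simps)
      also have "\<dots> \<in> ?I"
        using ab[of k x] ab[of "k - 1" x] 3(1) weight[OF 3]
        by (intro convexD[OF convex_real_interval(5)]) auto
      finally show ?thesis by simp
    qed (use ab[of 0 x] ab[of N x] QL QR in auto)
  qed
  have Q_nonneg: "quad_form (Q \<tau>) x \<ge> 0" for \<tau> x
    using order_trans[OF _ conjunct1[OF Qab]] \<open>a > 0\<close> by simp
  \<comment> \<open>Comparing the two bounds at any unit vector gives this; it yields the overshoot
    constant at least 1.\<close>
  have "a \<le> b"
    using ab[of 0 "axis undefined 1"] by (simp add: norm_axis_1)

  \<comment> \<open>The smallest rate works on all pieces at once: the form of
    \<open>Q \<tau>\<close> is nonnegative, so replacing \<open>\<epsilon> k\<close> by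
    \<open>r\<close> only decreases the left side.\<close>
  define r where "r = Min (\<epsilon> ` {0..N})"
  have r: "r > 0" "\<And>k. k \<le> N \<Longrightarrow> r \<le> \<epsilon> k"
    unfolding r_def using assms(6) by (subst Min_gr_iff) auto
  have mono: "exp (r * b) * quad_form (Q b) (x b) \<le> exp (r * a) * quad_form (Q a) (x a)"
    if sol: "solves_ltv_from \<A> s x" and "s \<le> a" "a \<le> b" for s x a b
  proof (rule piecewise_antimono[of s t "\<lambda>\<tau>. exp (r * \<tau>) * quad_form (Q \<tau>) (x \<tau>)" N a b])
    have x: "(x has_vector_derivative (\<A> \<tau> *v x \<tau>)) (at \<tau> within {a..b})"
      if "s \<le> a" "\<tau> \<in> {a..b}" for a b \<tau>
      using sol that unfolding solves_ltv_from_def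
      by (auto intro: has_vector_derivative_within_subset[of x _ \<tau> "{s..}"])
    have const: "exp (r * b) * quad_form (P k) (x b) \<le> exp (r * a) * quad_form (P k) (x a)"
      if "k \<le> N" "negative_definite (P k ** A k + transpose (A k) ** P k + \<epsilon> k *\<^sub>R P k)"
        "s \<le> a" "a \<le> b" "\<And>\<tau>. \<tau> \<in> {a..b} \<Longrightarrow> \<A> \<tau> = A k" for k a b
    proof -
      \<comment> \<open>The zero increment with zero weight only brings the constant matrix
        \<open>P k\<close> into the shape required by \<open>lyapunov_decay\<close>.\<close>
      have "exp (r * b) * quad_form (P k + 0 *\<^sub>R 0) (x b) \<le> exp (r * a) * quad_form (P k + 0 *\<^sub>R 0) (x a)"
      proof (rule lyapunov_decay[of a b "P k" 0 x \<A> "\<lambda>_. 0" 0 r])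
        show "symmetric_matrix (0 :: real^'n^'n)"
          by (simp add: symmetric_matrix_def transpose_def vec_eq_iff)
        fix \<tau> assume \<tau>: "\<tau> \<in> {a..b}"
        show "(x has_vector_derivative \<A> \<tau> *v x \<tau>) (at \<tau> within {a..b})"
          by (rule x[OF that(3) \<tau>])
        from \<tau> have "\<A> \<tau> = A k" by (rule that(5))
        moreover have "2 * (x \<tau> \<bullet> (P k *v (A k *v x \<tau>))) + \<epsilon> k * quad_form (P k) (x \<tau>) \<le> 0"
          using quad_form_nonpos[OF that(2), of "x \<tau>"]
          by (simp add: quad_form_add[of _ "\<epsilon> k *\<^sub>R P k"] quad_form_scaleR quad_form_lyapunov sym that(1))
        moreover have "r * quad_form (P k) (x \<tau>) \<le> \<epsilon> k * quad_form (P k) (x \<tau>)"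
          using r(2) quad_form_nonneg[OF pos] that(1) by (intro mult_right_mono)
        ultimately show "2 * (x \<tau> \<bullet> ((P k + 0 *\<^sub>R 0) *v (\<A> \<tau> *v x \<tau>))) + 0 * quad_form 0 (x \<tau>)
            + r * quad_form (P k + 0 *\<^sub>R 0) (x \<tau>) \<le> 0"
          by simp
      qed (use that sym in auto)
      then show ?thesis by simp
    qed
    show "exp (r * b) * quad_form (Q b) (x b) \<le> exp (r * a) * quad_form (Q a) (x a)"
      if "s \<le> a" "a \<le> b" "b \<le> t 0" for a b
      using const[of 0 a b] that neg0 QL assms(4) by auto
    show "exp (r * b) * quad_form (Q b) (x b) \<le> exp (r * a) * quad_form (Q a) (x a)"
      if "s \<le> a" "t N \<le> a" "a \<le> b" for a b
      using const[of N a b] that negN QR assms(5) by auto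
    show "exp (r * b) * quad_form (Q b) (x b) \<le> exp (r * a) * quad_form (Q a) (x a)"
      if k: "k \<in> {1..N}" and "s \<le> a" "t (k - 1) \<le> a" "a \<le> b" "b \<le> t k" for k a b
    proof -
      let ?w = "interp_weight t k" and ?D = "P k - P (k - 1)"
      have in_k: "\<tau> \<in> {t (k - 1)..t k}" if "\<tau> \<in> {a..b}" for \<tau>
        using that \<open>t (k - 1) \<le> a\<close> \<open>b \<le> t k\<close> by auto
      have "exp (r * b) * quad_form (P (k - 1) + ?w b *\<^sub>R ?D) (x b)
        \<le> exp (r * a) * quad_form (P (k - 1) + ?w a *\<^sub>R ?D) (x a)"
      proof (rule lyapunov_decay[of a b "P (k - 1)" ?D x \<A> ?w "\<gamma> k" r])
        show "symmetric_matrix (P (k - 1))"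
          using k by (intro sym) auto
        show "symmetric_matrix ?D"
          using sym[of k] sym[of "k - 1"] k
          by (auto simp: symmetric_matrix_def transpose_def vec_eq_iff)
        fix \<tau> assume \<tau>: "\<tau> \<in> {a..b}"
        \<comment> \<open>The weight climbs from 0 to 1 over the interval, so its slope is the
          inverse length; this is the origin of the \<open>\<gamma>\<close> term in N.\<close>
        show "(?w has_real_derivative \<gamma> k) (at \<tau> within {a..b})"
          unfolding interp_weight_def assms(7)[OF k] inverse_eq_divide
          by (rule DERIV_cdivide) (auto intro!: derivative_eq_intros)
        have Q: "Q \<tau> = P (k - 1) + ?w \<tau> *\<^sub>R ?D"
          by (rule QM[OF k in_k[OF \<tau>]])
        have A: "\<A> \<tau> = ?w \<tau> *\<^sub>R A k + (1 - ?w \<tau>) *\<^sub>R A (k - 1)"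
          by (rule assms(3)[OF k in_k[OF \<tau>]])
        have "2 * (x \<tau> \<bullet> (Q \<tau> *v (\<A> \<tau> *v x \<tau>))) + \<gamma> k * quad_form ?D (x \<tau>)
            + \<epsilon> k * quad_form (Q \<tau>) (x \<tau>) \<le> 0"
          unfolding Q A interval_form_eq
          using mid[OF k] weight[OF k in_k[OF \<tau>]] by (intro block_negative_imp_form_nonpos) auto
        moreover have "r * quad_form (Q \<tau>) (x \<tau>) \<le> \<epsilon> k * quad_form (Q \<tau>) (x \<tau>)"
          using r(2)[of k] k Q_nonneg by (intro mult_right_mono) auto
        ultimately show "2 * (x \<tau> \<bullet> ((P (k - 1) + ?w \<tau> *\<^sub>R ?D) *v (\<A> \<tau> *v x \<tau>)))
            + \<gamma> k * quad_form ?D (x \<tau>) + r * quad_form (P (k - 1) + ?w \<tau> *\<^sub>R ?D) (x \<tau>) \<le> 0"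
          unfolding Q[symmetric] by linarith
      qed (use that x in auto)
      then show ?thesis
        using QM[OF k in_k] \<open>a \<le> b\<close> by simp
    qed
  qed (use that in auto)

  \<comment> \<open>The estimate for the squared norm has factor \<open>b / a\<close> and rate
    \<open>r\<close>; the square root turns them into \<open>sqrt (b / a)\<close> and
    \<open>r / 2\<close>.\<close>
  have "norm (x \<tau>) \<le> sqrt (b / a) * exp (- (r / 2) * (\<tau> - s)) * norm (x s)"
    if "solves_ltv_from \<A> s x" "s \<le> \<tau>" for s x \<tau>
  proof (rule power2_le_imp_le)
    have "exp (r * \<tau>) * (a * (norm (x \<tau>))\<^sup>2) \<le> exp (r * \<tau>) * quad_form (Q \<tau>) (x \<tau>)"
      using Qab by simp
    also have "\<dots> \<le> exp (r * s) * quad_form (Q s) (x s)"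
      using mono[OF that(1) order_refl that(2)] .
    also have "\<dots> \<le> exp (r * s) * (b * (norm (x s))\<^sup>2)"
      using Qab by simp
    finally have "(norm (x \<tau>))\<^sup>2 \<le> b / a * (exp (r * s) / exp (r * \<tau>)) * (norm (x s))\<^sup>2"
      using \<open>a > 0\<close> by (simp add: field_simps)
    also have "exp (r * s) / exp (r * \<tau>) = (exp (- (r / 2) * (\<tau> - s)))\<^sup>2"
      by (simp add: exp_diff[symmetric] exp_double[symmetric] field_simps)
    finally show "(norm (x \<tau>))\<^sup>2 \<le> (sqrt (b / a) * exp (- (r / 2) * (\<tau> - s)) * norm (x s))\<^sup>2"
      using \<open>a > 0\<close> \<open>a \<le> b\<close> by (simp add: power_mult_distrib)
  qed (use \<open>a > 0\<close> \<open>a \<le> b\<close> in simp)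
  moreover have "sqrt (b / a) \<ge> 1"
    using \<open>a > 0\<close> \<open>a \<le> b\<close> by simp
  moreover have "r / 2 > 0" using r by simp
  ultimately show ?thesis
    unfolding globally_uniformly_exponentially_stable_def by blast
qed

end
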